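(* Consider the sparse matrix polynomial optimization problem $$f_{\min}=\min_{x\in\mathbb{R}^n}\ f(x)=f_1(x_{\Delta_1})+\cdots+f_m(x_{\Delta_m})\quad\text{s.t.}\quad G_i(x_{\Delta_i})\succeq 0,\ i=1,\ldots,m. \qquad (P)$$ Let $k\ge k_0$ and let $y^*$ be a minimizer of the $k$th order sparse moment relaxation. Suppose there exists an integer $t\in[k_0,k]$ such that the flat truncation condition $$r_i:=\mathrm{rank}\,M_{\Delta_i}^{(t)}[y^*_{\Delta_i}]=\mathrm{rank}\,M_{\Delta_i}^{(t-d_i)}[y^*_{\Delta_i}],\quad i=1,\ldots,m,$$ holds, and such that $f_t^{smo}=f_k^{smo}$. Let $\mathcal{X}_{\Delta_i}=\{u^{(i,1)},\ldots,u^{(i,r_i)}\}\subseteq K_{\Delta_i}$ be the associated support sets (see context). (i) If $x^*\in\mathbb{R}^n$ satisfies $x^*_{\Delta_i}\in\mathcal{X}_{\Delta_i}$ for all $i=1,\ldots,m$, then $f_{\min}=f_k^{smo}$ and $x^*$ is a minimizer of $(P)$. (ii) In item (i), if, in addition, there is no duality gap between the $k$th order sparse SOS relaxation and the $k$th order sparse moment relaxation (i.e., $f_k^{spa}=f_k^{smo}$), then $f_{\min}=f_k^{spa}$.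
   Context: Let $[m]=\{1,\ldots,m\}$. $\Delta_1,\ldots,\Delta_m$ are subsets of $[n]$ with $\Delta_1\cup\cdots\cup\Delta_m=[n]$; $n_i=|\Delta_i|$. For $x\in\mathbb{R}^n$, $x_{\Delta_i}$ is the subvector $(x_j)_{j\in\Delta_i}$. $\mathbb{R}[x_{\Delta_i}]$ is the ring of real polynomials in $x_{\Delta_i}$, and $\mathbb{R}[x_{\Delta_i}]_{d}$ its subset of polynomials of degree at most $d$. Each $f_i\in\mathbb{R}[x_{\Delta_i}]$, and each $G_i$ is an $\ell_i\times\ell_i$ symmetric matrix with entries in $\mathbb{R}[x_{\Delta_i}]$; $\deg(G_i)$ is the maximum degree of its entries. $X\succeq0$ means $X$ is positive semidefinite. $K_{\Delta_i}=\{x_{\Delta_i}\in\mathbb{R}^{n_i}: G_i(x_{\Delta_i})\succeq0\}$, the feasible set is $K=\{x\in\mathbb{R}^n: G_i(x_{\Delta_i})\succeq 0,\ i\in[m]\}$, and $f_{\min}$ is the infimum of $f$ on $K$. Put $d_i=\lceil\deg(G_i)/2\rceil$ and $k_0=\max_{i\in[m]}\big(\lceil\deg(f_i)/2\rceil,\lceil\deg(G_i)/2\rceil\big)$. SOS relaxation: $\Sigma[x_{\Delta_i}]_{2k}$ is the set of sums of squares of polynomials in $\mathbb{R}[x_{\Delta_i}]$ having degree at most $2k$; $$\mathrm{QM}_{\Delta_i}[G_i]_{2k}=\Sigma[x_{\Delta_i}]_{2k}+\Big\{\sum_{j=1}^sP_j^TG_iP_j:\ s\in\mathbb{N},\ P_j\in\mathbb{R}[x_{\Delta_i}]^{\ell_i},\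 2\deg(P_j)+\deg(G_i)\le 2k\Big\},$$ $\mathrm{QM}[G]_{spa,2k}=\sum_{i=1}^m\mathrm{QM}_{\Delta_i}[G_i]_{2k}$, and $f_k^{spa}=\sup\{\gamma: f-\gamma\in\mathrm{QM}[G]_{spa,2k}\}$. Moment relaxation: $\mathbb{N}^{\Delta_i}_d=\{\alpha\in\mathbb{N}^n:\alpha_j=0\ \forall j\notin\Delta_i,\ |\alpha|\le d\}$, $[x_{\Delta_i}]_d=(x^\alpha)_{\alpha\in\mathbb{N}^{\Delta_i}_d}$ is the vector of monomials, and $\mathbb{U}_k=\bigcup_{i=1}^m\mathbb{N}^{\Delta_i}_{2k}$. For $y=(y_\alpha)_{\alpha\in\mathbb{U}_k}\in\mathbb{R}^{\mathbb{U}_k}$, $y_{\Delta_i}=(y_\alpha)_{\alpha\in\mathbb{N}^{\Delta_i}_{2k}}$. The Riesz functional $\mathscr{L}_{y_{\Delta_i}}:\mathbb{R}[x_{\Delta_i}]_{2k}\to\mathbb{R}$ is linear with $\mathscr{L}_{y_{\Delta_i}}(x^\alpha)=y_\alpha$; write $\langle p,y_{\Delta_i}\rangle=\mathscr{L}_{y_{\Delta_i}}(p)$. For $s\le k$, $M^{(s)}_{\Delta_i}[y_{\Delta_i}]=\mathscr{L}_{y_{\Delta_i}}([x_{\Delta_i}]_s[x_{\Delta_i}]_s^T)$ (applied entrywise) is the moment matrix, and the localizing matrix $L^{(s)}_{G_i}[y_{\Delta_i}]$ is the $\ell_i\times\ell_i$ block matrix whose $(a,b)$ block is $\mathscr{L}_{y_{\Delta_i}}\big((G_i)_{ab}\,[x_{\Delta_i}]_{s'}[x_{\Delta_i}]_{s'}^T\big)$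 with $s'=\lfloor s-\deg(G_i)/2\rfloor$. The $k$th order sparse moment relaxation ($k\ge k_0$), with optimal value $f_k^{smo}$, is $$\min_{y\in\mathbb{R}^{\mathbb{U}_k}}\ \langle f,y\rangle:=\sum_{i=1}^m\langle f_i,y_{\Delta_i}\rangle\quad\text{s.t.}\quad L^{(k)}_{G_i}[y_{\Delta_i}]\succeq0,\ M^{(k)}_{\Delta_i}[y_{\Delta_i}]\succeq0\ (i\in[m]),\ y_0=1.$$ Support sets: under the flat truncation condition, for each $i$ there exist distinct points $u^{(i,1)},\ldots,u^{(i,r_i)}\in K_{\Delta_i}$ and scalars $\lambda_{i,1},\ldots,\lambda_{i,r_i}>0$ with $\sum_j\lambda_{i,j}=1$ such that $$y^*_{\Delta_i}|_{2t}=\lambda_{i,1}[u^{(i,1)}]_{2t}+\cdots+\lambda_{i,r_i}[u^{(i,r_i)}]_{2t},$$ where $y_{\Delta_i}|_{2t}=(y_\alpha)_{\alpha\in\mathbb{N}^{\Delta_i}_{2t}}$ and $[u]_{2t}$ is the vector $[x_{\Delta_i}]_{2t}$ evaluated at $u$ (this existence is a known result). $\mathcal{X}_{\Delta_i}=\{u^{(i,1)},\ldots,u^{(i,r_i)}\}$ denotes this set of points. *)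

theory Defs
  imports
    Jordan_Normal_Form.DL_Rank
    "HOL-Library.Poly_Mapping"
    "HOL-Library.Extended_Real"
    "HOL-Library.FuncSet"
begin

section \<open>Real polynomials in the variables indexed by a finite type\<close>

text \<open>
  The index set of the variables is a finite type \<open>'n\<close>. A point of the whole space
  is a function \<open>'n \<Rightarrow> real\<close>; a point of the coordinate subspace of \<open>\<Delta> \<subseteq> UNIV\<close>
  is an element of \<open>\<Delta> \<rightarrow>\<^sub>E UNIV\<close>, and the subvector of \<open>x\<close> is \<open>restrict x \<Delta>\<close>.
\<close>

type_synonym 'n expo = "'n \<Rightarrow>\<^sub>0 nat"
type_synonym 'n rpoly = "('n \<Rightarrow>\<^sub>0 nat) \<Rightarrow>\<^sub>0 real"

definition expo_deg :: "'n::finite expo \<Rightarrow> nat" where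
  "expo_deg \<alpha> = (\<Sum>j\<in>UNIV. Poly_Mapping.lookup \<alpha> j)"

text \<open>The zero polynomial gets degree 0.\<close>

definition poly_deg :: "'n::finite rpoly \<Rightarrow> nat" where
  "poly_deg p = Max (insert 0 (expo_deg ` Poly_Mapping.keys p))"

definition mat_deg :: "'n::finite rpoly mat \<Rightarrow> nat" where
  "mat_deg G = Max (insert 0 (poly_deg ` elements_mat G))"

definition vec_deg :: "'n::finite rpoly vec \<Rightarrow> nat" where
  "vec_deg P = Max (insert 0 (poly_deg ` set\<^sub>v P))"

definition const_poly :: "real \<Rightarrow> 'n rpoly" where
  "const_poly c = Poly_Mapping.single 0 c"

definition monom_poly :: "'n expo \<Rightarrow> 'n rpoly" where
  "monom_poly \<alpha> = Poly_Mapping.single \<alpha> 1"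

definition monom_eval :: "'n::finite expo \<Rightarrow> ('n \<Rightarrow> real) \<Rightarrow> real" where
  "monom_eval \<alpha> x = (\<Prod>j\<in>UNIV. x j ^ Poly_Mapping.lookup \<alpha> j)"

definition poly_eval :: "'n::finite rpoly \<Rightarrow> ('n \<Rightarrow> real) \<Rightarrow> real" where
  "poly_eval p x = (\<Sum>\<alpha>\<in>Poly_Mapping.keys p. Poly_Mapping.lookup p \<alpha> * monom_eval \<alpha> x)"

definition polys_in :: "'n set \<Rightarrow> 'n rpoly set" where
  "polys_in \<Delta> = {p. \<forall>\<alpha>\<in>Poly_Mapping.keys p. Poly_Mapping.keys \<alpha> \<subseteq> \<Delta>}"

definition psd :: "real mat \<Rightarrow> bool" where
  "psd A \<longleftrightarrow> square_mat A \<and> transpose_mat A = A \<and>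
     (\<forall>v\<in>carrier_vec (dim_row A). 0 \<le> v \<bullet> (A *\<^sub>v v))"

section \<open>The sparse matrix polynomial optimization problem\<close>

definition block_feasible :: "'n::finite set \<Rightarrow> 'n rpoly mat \<Rightarrow> ('n \<Rightarrow> real) set" where
  "block_feasible \<Delta> G = {u \<in> \<Delta> \<rightarrow>\<^sub>E UNIV. psd (map_mat (\<lambda>p. poly_eval p u) G)}"

definition feasible ::
  "nat \<Rightarrow> (nat \<Rightarrow> 'n::finite set) \<Rightarrow> (nat \<Rightarrow> 'n rpoly mat) \<Rightarrow> ('n \<Rightarrow> real) set" where
  "feasible m \<Delta> G = {x. \<forall>i\<in>{1..m}. restrict x (\<Delta> i) \<in> block_feasible (\<Delta> i) (G i)}"

definition objective :: "nat \<Rightarrow> (nat \<Rightarrow> 'n rpoly) \<Rightarrow> 'n rpoly" where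
  "objective m f = (\<Sum>i=1..m. f i)"

text \<open>
  Optimal values are extended reals: the infimum (supremum) over an empty set is
  \<open>\<infinity>\<close> (\<open>-\<infinity>\<close>).
\<close>

definition f_min ::
  "nat \<Rightarrow> (nat \<Rightarrow> 'n::finite set) \<Rightarrow> (nat \<Rightarrow> 'n rpoly) \<Rightarrow> (nat \<Rightarrow> 'n rpoly mat) \<Rightarrow> ereal" where
  "f_min m \<Delta> f G = (INF x\<in>feasible m \<Delta> G. ereal (poly_eval (objective m f) x))"

definition half_deg :: "nat \<Rightarrow> nat" where
  "half_deg d = nat \<lceil>real d / 2\<rceil>"

definition min_order :: "nat \<Rightarrow> (nat \<Rightarrow> 'n::finite rpoly) \<Rightarrow> (nat \<Rightarrow> 'n rpoly mat) \<Rightarrow> nat" where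
  "min_order m f G =
     Max ((\<lambda>i. max (half_deg (poly_deg (f i))) (half_deg (mat_deg (G i)))) ` {1..m})"

section \<open>The sparse SOS relaxation\<close>

definition sos :: "'n::finite set \<Rightarrow> nat \<Rightarrow> 'n rpoly set" where
  "sos \<Delta> d = {\<sigma>. poly_deg \<sigma> \<le> d \<and> (\<exists>ps. set ps \<subseteq> polys_in \<Delta> \<and> \<sigma> = (\<Sum>p\<leftarrow>ps. p ^ 2))}"

definition qmod :: "'n::finite set \<Rightarrow> 'n rpoly mat \<Rightarrow> nat \<Rightarrow> 'n rpoly set" where
  "qmod \<Delta> G d = {\<sigma> + (\<Sum>P\<leftarrow>Ps. P \<bullet> (G *\<^sub>v P)) | \<sigma> Ps.
     \<sigma> \<in> sos \<Delta> d \<and>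
     (\<forall>P\<in>set Ps. P \<in> carrier_vec (dim_row G) \<and> set\<^sub>v P \<subseteq> polys_in \<Delta> \<and>
        2 * vec_deg P + mat_deg G \<le> d)}"

definition qmod_sparse ::
  "nat \<Rightarrow> (nat \<Rightarrow> 'n::finite set) \<Rightarrow> (nat \<Rightarrow> 'n rpoly mat) \<Rightarrow> nat \<Rightarrow> 'n rpoly set" where
  "qmod_sparse m \<Delta> G d = {(\<Sum>i=1..m. q i) | q. \<forall>i\<in>{1..m}. q i \<in> qmod (\<Delta> i) (G i) d}"

definition f_spa ::
  "nat \<Rightarrow> (nat \<Rightarrow> 'n::finite set) \<Rightarrow> (nat \<Rightarrow> 'n rpoly) \<Rightarrow> (nat \<Rightarrow> 'n rpoly mat) \<Rightarrow> nat \<Rightarrow> ereal" where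
  "f_spa m \<Delta> f G k =
     (SUP \<gamma>\<in>{\<gamma>. objective m f - const_poly \<gamma> \<in> qmod_sparse m \<Delta> G (2 * k)}. ereal \<gamma>)"

section \<open>The sparse moment relaxation\<close>

definition expos :: "'n::finite set \<Rightarrow> nat \<Rightarrow> 'n expo set" where
  "expos \<Delta> d = {\<alpha>. Poly_Mapping.keys \<alpha> \<subseteq> \<Delta> \<and> expo_deg \<alpha> \<le> d}"

lemma finite_expos: "finite (expos \<Delta> d)"
proof (rule finite_imageD)
  have le: "Poly_Mapping.lookup \<alpha> j \<le> d" if "\<alpha> \<in> expos \<Delta> d" for \<alpha> j
  proof -
    have "Poly_Mapping.lookup \<alpha> j \<le> (\<Sum>j\<in>UNIV. Poly_Mapping.lookup \<alpha> j)"
      by (rule member_le_sum) auto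
    with that show ?thesis by (simp add: expos_def expo_deg_def)
  qed
  have "Poly_Mapping.lookup ` expos \<Delta> d \<subseteq> (UNIV :: 'a set) \<rightarrow>\<^sub>E {..d}"
    using le by auto
  then show "finite (Poly_Mapping.lookup ` expos \<Delta> d)"
    by (rule finite_subset) (simp add: finite_PiE)
  show "inj_on Poly_Mapping.lookup (expos \<Delta> d)"
    by (simp add: inj_on_def)
qed

text \<open>
  A fixed but unspecified order of the monomials: it only permutes rows and columns of the
  matrices below, so rank and positive semidefiniteness do not depend on it.
\<close>

definition expo_list :: "'n::finite set \<Rightarrow> nat \<Rightarrow> 'n expo list" where
  "expo_list \<Delta> d = (SOME as. distinct as \<and> set as = expos \<Delta> d)"

lemma expo_list: "distinct (expo_list \<Delta> d)" "set (expo_list \<Delta> d) = expos \<Delta> d"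
proof -
  have "\<exists>as. distinct as \<and> set as = expos \<Delta> d"
    using finite_distinct_list[OF finite_expos] by blast
  from someI_ex[OF this] show "distinct (expo_list \<Delta> d)" "set (expo_list \<Delta> d) = expos \<Delta> d"
    by (simp_all add: expo_list_def)
qed

definition monom_vec :: "'n::finite set \<Rightarrow> nat \<Rightarrow> 'n rpoly vec" where
  "monom_vec \<Delta> d = vec_of_list (map monom_poly (expo_list \<Delta> d))"

definition monom_outer :: "'n::finite set \<Rightarrow> nat \<Rightarrow> 'n rpoly mat" where
  "monom_outer \<Delta> d = (let v = monom_vec \<Delta> d in
     mat (dim_vec v) (dim_vec v) (\<lambda>(a, b). v $ a * v $ b))"

definition riesz :: "('n expo \<Rightarrow> real) \<Rightarrow> 'n rpoly \<Rightarrow> real" where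
  "riesz z p = (\<Sum>\<alpha>\<in>Poly_Mapping.keys p. Poly_Mapping.lookup p \<alpha> * z \<alpha>)"

definition moment_mat :: "'n::finite set \<Rightarrow> nat \<Rightarrow> ('n expo \<Rightarrow> real) \<Rightarrow> real mat" where
  "moment_mat \<Delta> s z = map_mat (riesz z) (monom_outer \<Delta> s)"

text \<open>
  With \<open>N\<close> the number of monomials, row (column) \<open>a * N + p\<close> of the block matrix is
  row (column) \<open>p\<close> within block row (column) \<open>a\<close>.
\<close>

definition localizing_mat ::
  "'n::finite set \<Rightarrow> 'n rpoly mat \<Rightarrow> nat \<Rightarrow> ('n expo \<Rightarrow> real) \<Rightarrow> real mat" where
  "localizing_mat \<Delta> G s z =
     (let W = monom_outer \<Delta> (nat \<lfloor>real s - real (mat_deg G) / 2\<rfloor>); N = dim_row W in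
      mat (dim_row G * N) (dim_col G * N)
        (\<lambda>(p, q). riesz z (G $$ (p div N, q div N) * W $$ (p mod N, q mod N))))"

definition mat_rank :: "real mat \<Rightarrow> nat" where
  "mat_rank A = vec_space.rank (dim_row A) A"

definition moment_index :: "nat \<Rightarrow> (nat \<Rightarrow> 'n::finite set) \<Rightarrow> nat \<Rightarrow> 'n expo set" where
  "moment_index m \<Delta> k = (\<Union>i\<in>{1..m}. expos (\<Delta> i) (2 * k))"

definition subseq_moments ::
  "'n::finite set \<Rightarrow> nat \<Rightarrow> ('n expo \<Rightarrow> real) \<Rightarrow> ('n expo \<Rightarrow> real)" where
  "subseq_moments \<Delta> k y = restrict y (expos \<Delta> (2 * k))"

definition smo_feasible ::
  "nat \<Rightarrow> (nat \<Rightarrow> 'n::finite set) \<Rightarrow> (nat \<Rightarrow> 'n rpoly mat) \<Rightarrow> nat \<Rightarrow> ('n expo \<Rightarrow> real) set" where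
  "smo_feasible m \<Delta> G k = {y \<in> moment_index m \<Delta> k \<rightarrow>\<^sub>E UNIV.
     (\<forall>i\<in>{1..m}. psd (localizing_mat (\<Delta> i) (G i) k (subseq_moments (\<Delta> i) k y)) \<and>
        psd (moment_mat (\<Delta> i) k (subseq_moments (\<Delta> i) k y))) \<and>
     y 0 = 1}"

definition smo_objective ::
  "nat \<Rightarrow> (nat \<Rightarrow> 'n::finite set) \<Rightarrow> (nat \<Rightarrow> 'n rpoly) \<Rightarrow> nat \<Rightarrow> ('n expo \<Rightarrow> real) \<Rightarrow> real" where
  "smo_objective m \<Delta> f k y = (\<Sum>i=1..m. riesz (subseq_moments (\<Delta> i) k y) (f i))"

definition f_smo ::
  "nat \<Rightarrow> (nat \<Rightarrow> 'n::finite set) \<Rightarrow> (nat \<Rightarrow> 'n rpoly) \<Rightarrow> (nat \<Rightarrow> 'n rpoly mat) \<Rightarrow> nat \<Rightarrow> ereal" where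
  "f_smo m \<Delta> f G k = (INF y\<in>smo_feasible m \<Delta> G k. ereal (smo_objective m \<Delta> f k y))"

end

theory Submission
  imports Defs
begin

text \<open>
  The moment relaxation is a relaxation in the following sense: the moments
  \<open>y \<alpha> = x\<^sup>\<alpha>\<close> of a feasible point \<open>x\<close> are feasible for it and have objective
  value \<open>f x\<close>, so \<open>f_smo \<le> f_min\<close> at every order from \<open>min_order\<close> on (\<open>f_smo_le_feasible\<close>). More generally, let
  \<open>y\<close> have, on the exponents of each block \<open>i\<close>, the moments of some finitely supported
  nonnegative measure on the feasible set of that block. The measures may differ between blocks;
  they only have to agree on the moments that the blocks share. If moreover \<open>y 0 = 1\<close>, then \<open>y\<close>
  is feasible (\<open>smo_feasible_atomic\<close>), because its moment and localizing matrices are nonnegative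
  combinations of those of single feasible points.

  Let now \<open>x\<close> be a point whose subvectors all lie in the support sets. It is feasible, and what
  is left to prove is that \<open>f x\<close> is at most the value \<open>v\<close> of the minimizer \<open>y\<close>. In each block
  \<open>i\<close>, the subvector of \<open>x\<close> is an atom of the representing measure. So for some
  \<open>0 < \<theta> < 1\<close> the mass \<open>\<theta>\<close> can be removed from this atom in all the blocks at once while every
  weight stays nonnegative. On the exponents of order \<open>t\<close> this gives a splitting
  \<open>y = \<theta> [x] + (1 - \<theta>) z\<close>, where \<open>z\<close> is again represented by measures on the blocks. It is
  globally consistent, because both \<open>y\<close> and \<open>[x]\<close> are. Hence \<open>z\<close> is feasible at order \<open>t\<close> and
  its objective is at least the optimal value there, which by hypothesis is \<open>v\<close>. The objective
  being affine, \<open>v \<ge> \<theta> f x + (1 - \<theta>) v\<close>, that is \<open>f x \<le> v\<close>. The equality of the optimal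
  values of orders \<open>t\<close> and \<open>k\<close> enters in this step, because \<open>z\<close> is a truncated sequence and need
  not extend to a feasible point of order \<open>k\<close>.
\<close>

section \<open>Evaluation and degrees of polynomials\<close>

lemma monom_eval_add: "monom_eval (\<alpha> + \<beta>) x = monom_eval \<alpha> x * monom_eval \<beta> x"
  by (simp add: monom_eval_def lookup_add power_add prod.distrib)

lemma monom_eval_zero [simp]: "monom_eval 0 x = 1"
  by (simp add: monom_eval_def)

lemma poly_eval_superset:
  assumes "finite S" "Poly_Mapping.keys p \<subseteq> S"
  shows "poly_eval p x = (\<Sum>\<alpha>\<in>S. Poly_Mapping.lookup p \<alpha> * monom_eval \<alpha> x)"
  unfolding poly_eval_def using assms
  by (intro sum.mono_neutral_left) (auto simp: in_keys_iff)

lemma poly_eval_add: "poly_eval (p + q) x = poly_eval p x + poly_eval q x"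
proof -
  let ?S = "Poly_Mapping.keys p \<union> Poly_Mapping.keys q"
  have "poly_eval r x = (\<Sum>\<alpha>\<in>?S. Poly_Mapping.lookup r \<alpha> * monom_eval \<alpha> x)"
    if "Poly_Mapping.keys r \<subseteq> ?S" for r
    using that by (intro poly_eval_superset) auto
  then show ?thesis
    using keys_add[of p q] by (simp add: lookup_add distrib_right sum.distrib)
qed

lemma poly_eval_zero [simp]: "poly_eval 0 x = 0"
  by (simp add: poly_eval_def)

lemma poly_eval_sum: "poly_eval (\<Sum>i\<in>I. p i) x = (\<Sum>i\<in>I. poly_eval (p i) x)"
  by (induction I rule: infinite_finite_induct) (simp_all add: poly_eval_add)

lemma poly_eval_single: "poly_eval (Poly_Mapping.single \<alpha> a) x = a * monom_eval \<alpha> x"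
  by (cases "a = 0") (simp_all add: poly_eval_def)

lemma poly_eval_mult_monom:
  "poly_eval (p * monom_poly \<beta>) x = poly_eval p x * monom_eval \<beta> x"
proof -
  have expand: "p = (\<Sum>\<alpha>\<in>Poly_Mapping.keys p. Poly_Mapping.single \<alpha> (Poly_Mapping.lookup p \<alpha>))"
    by (intro poly_mapping_eqI)
       (simp add: lookup_sum lookup_single when_def in_keys_iff)
  have "p * monom_poly \<beta> =
      (\<Sum>\<alpha>\<in>Poly_Mapping.keys p. Poly_Mapping.single (\<alpha> + \<beta>) (Poly_Mapping.lookup p \<alpha>))"
    by (subst expand) (simp add: sum_distrib_right monom_poly_def mult_single)
  then show ?thesis
    by (simp add: poly_eval_sum poly_eval_single monom_eval_add poly_eval_def[of p]
        sum_distrib_right mult.assoc)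
qed

lemma monom_eval_restrict:
  assumes "Poly_Mapping.keys \<alpha> \<subseteq> \<Delta>"
  shows "monom_eval \<alpha> (restrict x \<Delta>) = monom_eval \<alpha> x"
  unfolding monom_eval_def
proof (rule prod.cong)
  fix j show "restrict x \<Delta> j ^ Poly_Mapping.lookup \<alpha> j = x j ^ Poly_Mapping.lookup \<alpha> j"
    using assms by (cases "Poly_Mapping.lookup \<alpha> j = 0") (auto simp: in_keys_iff subset_iff)
qed simp

lemma poly_eval_restrict:
  assumes "p \<in> polys_in \<Delta>"
  shows "poly_eval p (restrict x \<Delta>) = poly_eval p x"
  using assms by (auto simp: poly_eval_def polys_in_def monom_eval_restrict intro!: sum.cong)

lemma expo_deg_add: "expo_deg (\<alpha> + \<beta>) = expo_deg \<alpha> + expo_deg \<beta>"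
  by (simp add: expo_deg_def lookup_add sum.distrib)

lemma zero_in_expos: "0 \<in> expos \<Delta> d"
  by (simp add: expos_def expo_deg_def)

lemma expos_add: "\<lbrakk>\<alpha> \<in> expos \<Delta> d; \<beta> \<in> expos \<Delta> e\<rbrakk> \<Longrightarrow> \<alpha> + \<beta> \<in> expos \<Delta> (d + e)"
  using keys_add[of \<alpha> \<beta>] by (auto simp: expos_def expo_deg_add)

lemma expos_mono: "d \<le> e \<Longrightarrow> expos \<Delta> d \<subseteq> expos \<Delta> e"
  by (auto simp: expos_def)

lemma keys_subset_expos:
  assumes "p \<in> polys_in \<Delta>" "poly_deg p \<le> d"
  shows "Poly_Mapping.keys p \<subseteq> expos \<Delta> d"
proof
  fix \<alpha> assume \<alpha>: "\<alpha> \<in> Poly_Mapping.keys p"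
  then have "expo_deg \<alpha> \<le> poly_deg p"
    by (auto simp: poly_deg_def intro!: Max_ge)
  with \<alpha> assms show "\<alpha> \<in> expos \<Delta> d"
    by (auto simp: polys_in_def expos_def)
qed

lemma poly_deg_le_mat_deg:
  assumes "G \<in> carrier_mat l l'" "a < l" "b < l'"
  shows "poly_deg (G $$ (a, b)) \<le> mat_deg G"
proof -
  have "G $$ (a, b) \<in> elements_mat G"
    using assms by auto
  moreover have "finite (elements_mat G)"
    by (simp add: elements_mat_def)
  ultimately show ?thesis
    by (auto simp: mat_deg_def intro!: Max_ge)
qed

section \<open>Quadratic forms\<close>

lemma psd_iff_quadratic_form:
  assumes A: "A \<in> carrier_mat n n"
  shows "psd A \<longleftrightarrow> (\<forall>p<n. \<forall>q<n. A $$ (p, q) = A $$ (q, p)) \<and>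
    (\<forall>w. 0 \<le> (\<Sum>p<n. \<Sum>q<n. w p * w q * A $$ (p, q)))"
proof -
  have form: "v \<bullet> (A *\<^sub>v v) = (\<Sum>p<n. \<Sum>q<n. v $ p * v $ q * A $$ (p, q))"
    if "v \<in> carrier_vec n" for v
    using that A
    by (auto simp: scalar_prod_def mult_mat_vec_def row_def sum_distrib_left atLeast0LessThan
        mult_ac intro!: sum.cong)
  have "(\<forall>v\<in>carrier_vec n. 0 \<le> v \<bullet> (A *\<^sub>v v)) \<longleftrightarrow>
      (\<forall>w. 0 \<le> (\<Sum>p<n. \<Sum>q<n. w p * w q * A $$ (p, q)))"
  proof safe
    fix w :: "nat \<Rightarrow> real"
    assume "\<forall>v\<in>carrier_vec n. 0 \<le> v \<bullet> (A *\<^sub>v v)"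
    then have "0 \<le> vec n w \<bullet> (A *\<^sub>v vec n w)"
      by simp
    then show "0 \<le> (\<Sum>p<n. \<Sum>q<n. w p * w q * A $$ (p, q))"
      by (simp add: form)
  qed (simp add: form)
  moreover have "transpose_mat A = A \<longleftrightarrow> (\<forall>p<n. \<forall>q<n. A $$ (p, q) = A $$ (q, p))"
    using A by (auto simp: mat_eq_iff)
  ultimately show ?thesis
    using A by (auto simp: psd_def)
qed

text \<open>
  The form on \<open>S\<close> at \<open>s\<close> equals the form on \<open>T\<close> at the vector \<open>w\<close> that collects the values of
  \<open>s\<close> over the fibres of \<open>g\<close>. With \<open>S\<close> the rows of a block matrix and \<open>g\<close> the map to the block
  row, this reduces a localizing matrix at a point \<open>u\<close> to the matrix \<open>G u\<close>.
\<close>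

lemma quadratic_form_pullback_nonneg:
  fixes A :: "'b \<Rightarrow> 'b \<Rightarrow> real"
  assumes "finite S" "finite T" "g ` S \<subseteq> T"
    and nonneg: "\<And>w. 0 \<le> (\<Sum>a\<in>T. \<Sum>b\<in>T. w a * w b * A a b)"
  shows "0 \<le> (\<Sum>p\<in>S. \<Sum>q\<in>S. s p * s q * A (g p) (g q))"
proof -
  define w where "w a = (\<Sum>p | p \<in> S \<and> g p = a. s p)" for a
  have collect: "(\<Sum>p\<in>S. s p * h (g p)) = (\<Sum>a\<in>T. w a * h a)" for h
    unfolding w_def sum_distrib_right
    by (subst sum.group[OF assms(1-3), symmetric]) (auto intro!: sum.cong)
  have "(\<Sum>p\<in>S. \<Sum>q\<in>S. s p * s q * A (g p) (g q)) =
      (\<Sum>p\<in>S. s p * (\<Sum>q\<in>S. s q * A (g p) (g q)))"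
    by (simp add: sum_distrib_left mult_ac)
  also have "\<dots> = (\<Sum>p\<in>S. s p * (\<Sum>b\<in>T. w b * A (g p) b))"
    by (simp only: collect)
  also have "\<dots> = (\<Sum>a\<in>T. w a * (\<Sum>b\<in>T. w b * A a b))"
    by (rule collect)
  also have "\<dots> = (\<Sum>a\<in>T. \<Sum>b\<in>T. w a * w b * A a b)"
    by (simp add: sum_distrib_left mult_ac)
  finally show ?thesis
    using nonneg by simp
qed

section \<open>Moments of finitely supported measures\<close>

text \<open>
  For finite \<open>J\<close> and nonnegative \<open>c\<close>, the sum is a moment of the measure with mass \<open>c j\<close> at
  each \<open>u j\<close>. Indexing by \<open>J\<close> allows repeated points and zero masses, so that
  mass may be moved away from an atom without changing the index set.
\<close>

definition atomic_on ::
  "'n::finite expo set \<Rightarrow> 'j set \<Rightarrow> ('j \<Rightarrow> real) \<Rightarrow> ('j \<Rightarrow> 'n \<Rightarrow> real) \<Rightarrow> ('n expo \<Rightarrow> real) \<Rightarrow> bool" where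
  "atomic_on S J c u z \<longleftrightarrow> (\<forall>\<alpha>\<in>S. z \<alpha> = (\<Sum>j\<in>J. c j * monom_eval \<alpha> (u j)))"

lemma riesz_atomic:
  assumes "atomic_on S J c u z" "Poly_Mapping.keys p \<subseteq> S"
  shows "riesz z p = (\<Sum>j\<in>J. c j * poly_eval p (u j))"
proof -
  have "riesz z p =
      (\<Sum>\<alpha>\<in>Poly_Mapping.keys p. \<Sum>j\<in>J. Poly_Mapping.lookup p \<alpha> * (c j * monom_eval \<alpha> (u j)))"
    using assms unfolding riesz_def atomic_on_def
    by (intro sum.cong) (auto simp: sum_distrib_left)
  also have "\<dots> = (\<Sum>j\<in>J. c j * poly_eval p (u j))"
    by (subst sum.swap) (simp add: poly_eval_def sum_distrib_left mult_ac)
  finally show ?thesis .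
qed

text \<open>
  The polynomials in the entries of the localizing matrix have exponents in the range where \<open>z\<close>
  is given by the measure. So the quadratic form of the matrix is the combination with weights
  \<open>c j\<close> of the forms at the atoms, and at the atom \<open>u j\<close> the form is that of \<open>G (u j)\<close> at the
  vector of values of polynomials at \<open>u j\<close>.
\<close>

lemma psd_localizing_mat_atomic:
  assumes G: "G \<in> carrier_mat l l" "elements_mat G \<subseteq> polys_in \<Delta>" "mat_deg G \<le> 2 * s"
    and z: "atomic_on (expos \<Delta> (2 * s)) J c u z"
    and c: "\<And>j. j \<in> J \<Longrightarrow> 0 \<le> c j"
    and u: "\<And>j. j \<in> J \<Longrightarrow> psd (map_mat (\<lambda>p. poly_eval p (u j)) G)"
  shows "psd (localizing_mat \<Delta> G s z)"
proof -
  define s' where "s' = nat \<lfloor>real s - real (mat_deg G) / 2\<rfloor>"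
  define as where "as = expo_list \<Delta> s'"
  define N where "N = length as"
  (* the value at the atom j of the monomial that indexes row p *)
  define \<mu> where "\<mu> j p = monom_eval (as ! (p mod N)) (u j)" for j p
  (* The bound on the degree of G keeps the floor nonnegative, so nat does not truncate. *)
  have deg: "mat_deg G + (s' + s') \<le> 2 * s"
    using G(3) unfolding s'_def by linarith
  have W: "monom_outer \<Delta> s' = mat N N (\<lambda>(a, b). monom_poly (as ! a) * monom_poly (as ! b))"
    by (auto simp: monom_outer_def monom_vec_def Let_def as_def N_def vec_of_list_index)
  have as: "as ! a \<in> expos \<Delta> s'" if "a < N" for a
    using that nth_mem[of a as] expo_list(2)[of \<Delta> s'] by (simp add: as_def N_def)
  define L where "L = localizing_mat \<Delta> G s z"
  have L: "L \<in> carrier_mat (l * N) (l * N)"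
    using G(1) by (simp add: L_def localizing_mat_def Let_def s'_def[symmetric] W)
  have entry: "L $$ (p, q) = (\<Sum>j\<in>J. c j * (\<mu> j p * \<mu> j q * poly_eval (G $$ (p div N, q div N)) (u j)))"
    if pq: "p < l * N" "q < l * N" for p q
  proof -
    have N: "0 < N" using pq by (cases N) auto
    have div: "p div N < l" "q div N < l"
      using pq by (simp_all add: less_mult_imp_div_less)
    let ?g = "G $$ (p div N, q div N)"
    let ?\<alpha> = "as ! (p mod N)" and ?\<beta> = "as ! (q mod N)"
    have "?g \<in> polys_in \<Delta>"
      using G div by auto
    then have g: "Poly_Mapping.keys ?g \<subseteq> expos \<Delta> (mat_deg G)"
      using poly_deg_le_mat_deg[OF G(1) div] by (rule keys_subset_expos)
    have "?\<alpha> + ?\<beta> \<in> expos \<Delta> (s' + s')"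
      using N by (intro expos_add as) simp_all
    then have "Poly_Mapping.keys (?g * monom_poly (?\<alpha> + ?\<beta>)) \<subseteq> expos \<Delta> (mat_deg G + (s' + s'))"
      using g keys_mult[of ?g "monom_poly (?\<alpha> + ?\<beta>)"]
      by (fastforce simp: monom_poly_def intro: expos_add)
    also note expos_mono[OF deg]
    finally have "riesz z (?g * monom_poly (?\<alpha> + ?\<beta>)) =
        (\<Sum>j\<in>J. c j * poly_eval (?g * monom_poly (?\<alpha> + ?\<beta>)) (u j))"
      by (rule riesz_atomic[OF z])
    moreover have "L $$ (p, q) = riesz z (?g * monom_poly (?\<alpha> + ?\<beta>))"
      using G(1) pq N
      by (simp add: L_def localizing_mat_def Let_def s'_def[symmetric] W monom_poly_def mult_single)
    ultimately show ?thesis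
      by (simp add: poly_eval_mult_monom monom_eval_add \<mu>_def mult_ac)
  qed
  have Gu: "map_mat (\<lambda>p. poly_eval p (u j)) G \<in> carrier_mat l l" for j
    using G(1) by simp
  note u' = u[unfolded psd_iff_quadratic_form[OF Gu]]
  have sym: "poly_eval (G $$ (a, b)) (u j) = poly_eval (G $$ (b, a)) (u j)"
    if "j \<in> J" "a < l" "b < l" for j a b
    using u'[OF that(1)] that G(1) by auto
  have form: "0 \<le> (\<Sum>a<l. \<Sum>b<l. w a * w b * poly_eval (G $$ (a, b)) (u j))" if "j \<in> J" for j w
  proof -
    have "0 \<le> (\<Sum>a<l. \<Sum>b<l. w a * w b * map_mat (\<lambda>p. poly_eval p (u j)) G $$ (a, b))"
      using u'[OF that] by blast
    also have "\<dots> = (\<Sum>a<l. \<Sum>b<l. w a * w b * poly_eval (G $$ (a, b)) (u j))"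
      using G(1) by (intro sum.cong) auto
    finally show ?thesis .
  qed
  have "L $$ (p, q) = L $$ (q, p)" if "p < l * N" "q < l * N" for p q
    using that by (auto simp: entry less_mult_imp_div_less intro!: sum.cong sym)
  moreover have "0 \<le> (\<Sum>p<l * N. \<Sum>q<l * N. w p * w q * L $$ (p, q))" for w
  proof -
    have "(\<Sum>p<l * N. \<Sum>q<l * N. w p * w q * L $$ (p, q)) =
        (\<Sum>p<l * N. \<Sum>q<l * N. \<Sum>j\<in>J. c j *
          ((w p * \<mu> j p) * (w q * \<mu> j q) * poly_eval (G $$ (p div N, q div N)) (u j)))"
      by (intro sum.cong) (simp_all add: entry sum_distrib_left mult_ac)
    also have "\<dots> = (\<Sum>p<l * N. \<Sum>j\<in>J. \<Sum>q<l * N. c j *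
          ((w p * \<mu> j p) * (w q * \<mu> j q) * poly_eval (G $$ (p div N, q div N)) (u j)))"
      by (intro sum.cong refl sum.swap)
    also have "\<dots> = (\<Sum>j\<in>J. \<Sum>p<l * N. \<Sum>q<l * N. c j *
          ((w p * \<mu> j p) * (w q * \<mu> j q) * poly_eval (G $$ (p div N, q div N)) (u j)))"
      by (rule sum.swap)
    also have "\<dots> = (\<Sum>j\<in>J. c j * (\<Sum>p<l * N. \<Sum>q<l * N.
          (w p * \<mu> j p) * (w q * \<mu> j q) * poly_eval (G $$ (p div N, q div N)) (u j)))"
      by (simp only: sum_distrib_left)
    also have "\<dots> \<ge> 0"
    proof (rule sum_nonneg)
      fix j assume j: "j \<in> J"
      have "0 \<le> (\<Sum>p<l * N. \<Sum>q<l * N.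
          (w p * \<mu> j p) * (w q * \<mu> j q) * poly_eval (G $$ (p div N, q div N)) (u j))"
        by (rule quadratic_form_pullback_nonneg[where T = "{..<l}" and g = "\<lambda>p. p div N"
              and A = "\<lambda>a b. poly_eval (G $$ (a, b)) (u j)"])
           (auto simp: less_mult_imp_div_less form[OF j])
      with c[OF j] show "0 \<le> c j * (\<Sum>p<l * N. \<Sum>q<l * N.
          (w p * \<mu> j p) * (w q * \<mu> j q) * poly_eval (G $$ (p div N, q div N)) (u j))"
        by (rule mult_nonneg_nonneg)
    qed
    finally show ?thesis .
  qed
  ultimately show ?thesis
    unfolding L_def[symmetric] psd_iff_quadratic_form[OF L] by simp
qed

lemma one_by_one_mat:
  "elements_mat (1\<^sub>m 1 :: 'n::finite rpoly mat) = {1}"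
  "mat_deg (1\<^sub>m 1 :: 'n::finite rpoly mat) = 0"
proof -
  show el: "elements_mat (1\<^sub>m 1 :: 'n rpoly mat) = {1}"
    by (auto simp: elements_mat_def)
  show "mat_deg (1\<^sub>m 1 :: 'n rpoly mat) = 0"
    unfolding mat_deg_def el by (simp add: poly_deg_def expo_deg_def)
qed

text \<open>
  The moment matrix is the localizing matrix of the constraint \<open>1 \<ge> 0\<close>, so its positive
  semidefiniteness is a special case of the previous result.
\<close>

lemma moment_mat_eq_localizing_mat: "moment_mat \<Delta> s z = localizing_mat \<Delta> (1\<^sub>m 1) s z"
  unfolding moment_mat_def localizing_mat_def Let_def one_by_one_mat
  by (auto simp: monom_outer_def Let_def)

lemma psd_moment_mat_atomic:
  assumes z: "atomic_on (expos \<Delta> (2 * s)) J c u z"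
    and c: "\<And>j. j \<in> J \<Longrightarrow> 0 \<le> c j"
  shows "psd (moment_mat \<Delta> s z)"
  unfolding moment_mat_eq_localizing_mat
proof (rule psd_localizing_mat_atomic[where l = 1, OF _ _ _ z c])
  show "elements_mat (1\<^sub>m 1) \<subseteq> polys_in \<Delta>" "mat_deg (1\<^sub>m 1 :: 'a rpoly mat) \<le> 2 * s"
    unfolding one_by_one_mat by (simp_all add: polys_in_def)
  fix j
  have "poly_eval (1 :: 'a rpoly) (u j) = 1"
    by (simp add: poly_eval_def)
  then show "psd (map_mat (\<lambda>p. poly_eval p (u j)) (1\<^sub>m 1))"
    by (subst psd_iff_quadratic_form[of _ 1]) simp_all
qed simp_all

section \<open>Feasible points of the moment relaxation\<close>

lemma deg_le_twice_order:
  assumes "min_order m f G \<le> k" "i \<in> {1..m}"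
  shows "poly_deg (f i) \<le> 2 * k" "mat_deg (G i) \<le> 2 * k"
proof -
  have "max (half_deg (poly_deg (f i))) (half_deg (mat_deg (G i))) \<le> min_order m f G"
    unfolding min_order_def using assms(2) by (intro Max_ge) auto
  with assms(1) have "half_deg (poly_deg (f i)) \<le> k" "half_deg (mat_deg (G i)) \<le> k"
    by auto
  then show "poly_deg (f i) \<le> 2 * k" "mat_deg (G i) \<le> 2 * k"
    unfolding half_deg_def by linarith+
qed

lemma atomic_subseq_moments:
  "atomic_on (expos \<Delta> (2 * k)) J c u y \<Longrightarrow>
   atomic_on (expos \<Delta> (2 * k)) J c u (subseq_moments \<Delta> k y)"
  by (simp add: atomic_on_def subseq_moments_def)

text \<open>
  Each block may have its own measure, since the constraints of the relaxation treat the blocks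
  separately; they are coupled only by being read off from the single sequence \<open>y\<close>.
\<close>

lemma smo_feasible_atomic:
  assumes k: "min_order m f G \<le> k"
    and G: "\<And>i. i \<in> {1..m} \<Longrightarrow> G i \<in> carrier_mat (l i) (l i)"
      "\<And>i. i \<in> {1..m} \<Longrightarrow> elements_mat (G i) \<subseteq> polys_in (\<Delta> i)"
    and y: "y \<in> moment_index m \<Delta> k \<rightarrow>\<^sub>E UNIV" "y 0 = 1"
    and atomic: "\<And>i. i \<in> {1..m} \<Longrightarrow> atomic_on (expos (\<Delta> i) (2 * k)) (J i) (c i) (u i) y"
    and c: "\<And>i j. i \<in> {1..m} \<Longrightarrow> j \<in> J i \<Longrightarrow> 0 \<le> c i j"
    and u: "\<And>i j. i \<in> {1..m} \<Longrightarrow> j \<in> J i \<Longrightarrow> u i j \<in> block_feasible (\<Delta> i) (G i)"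
  shows "y \<in> smo_feasible m \<Delta> G k"
  unfolding smo_feasible_def mem_Collect_eq
proof (intro conjI ballI y)
  fix i assume i: "i \<in> {1..m}"
  note at = atomic_subseq_moments[OF atomic[OF i]]
  show "psd (moment_mat (\<Delta> i) k (subseq_moments (\<Delta> i) k y))"
    using at c[OF i] by (rule psd_moment_mat_atomic)
  show "psd (localizing_mat (\<Delta> i) (G i) k (subseq_moments (\<Delta> i) k y))"
    using G[OF i] deg_le_twice_order(2)[OF k i] at c[OF i]
    by (rule psd_localizing_mat_atomic) (use u[OF i] in \<open>auto simp: block_feasible_def\<close>)
qed

lemma smo_objective_atomic:
  assumes k: "min_order m f G \<le> k"
    and f: "\<And>i. i \<in> {1..m} \<Longrightarrow> f i \<in> polys_in (\<Delta> i)"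
    and atomic: "\<And>i. i \<in> {1..m} \<Longrightarrow> atomic_on (expos (\<Delta> i) (2 * k)) (J i) (c i) (u i) y"
  shows "smo_objective m \<Delta> f k y = (\<Sum>i=1..m. \<Sum>j\<in>J i. c i j * poly_eval (f i) (u i j))"
  unfolding smo_objective_def
proof (rule sum.cong)
  fix i assume i: "i \<in> {1..m}"
  show "riesz (subseq_moments (\<Delta> i) k y) (f i) = (\<Sum>j\<in>J i. c i j * poly_eval (f i) (u i j))"
    using atomic_subseq_moments[OF atomic[OF i]]
      keys_subset_expos[OF f[OF i] deg_le_twice_order(1)[OF k i]]
    by (rule riesz_atomic)
qed simp

text \<open>
  The moments of a feasible point \<open>x\<close> are represented in block \<open>i\<close> by the unit mass at the
  subvector of \<open>x\<close>. There has to be a block for the exponent \<open>0\<close> to belong to the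
  moment index set.
\<close>

lemma f_smo_le_feasible:
  assumes m: "1 \<le> m"
    and k: "min_order m f G \<le> k"
    and f: "\<And>i. i \<in> {1..m} \<Longrightarrow> f i \<in> polys_in (\<Delta> i)"
    and G: "\<And>i. i \<in> {1..m} \<Longrightarrow> G i \<in> carrier_mat (l i) (l i)"
      "\<And>i. i \<in> {1..m} \<Longrightarrow> elements_mat (G i) \<subseteq> polys_in (\<Delta> i)"
    and x: "x \<in> feasible m \<Delta> G"
  shows "f_smo m \<Delta> f G k \<le> ereal (poly_eval (objective m f) x)"
proof -
  define z where "z = (\<lambda>\<alpha>\<in>moment_index m \<Delta> k. monom_eval \<alpha> x)"
  have atomic: "atomic_on (expos (\<Delta> i) (2 * k)) {()} (\<lambda>_. 1) (\<lambda>_. restrict x (\<Delta> i)) z"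
    if "i \<in> {1..m}" for i
    using that by (auto simp: atomic_on_def z_def moment_index_def monom_eval_restrict expos_def)
  have "0 \<in> moment_index m \<Delta> k"
    using m zero_in_expos by (fastforce simp: moment_index_def)
  then have "z 0 = 1" "z \<in> moment_index m \<Delta> k \<rightarrow>\<^sub>E UNIV"
    by (auto simp: z_def)
  then have "z \<in> smo_feasible m \<Delta> G k"
    using x by (intro smo_feasible_atomic[OF k G _ _ atomic]) (auto simp: feasible_def)
  then have "f_smo m \<Delta> f G k \<le> ereal (smo_objective m \<Delta> f k z)"
    unfolding f_smo_def by (rule INF_lower)
  also have "smo_objective m \<Delta> f k z = poly_eval (objective m f) x"
    using smo_objective_atomic[OF k f atomic] f
    by (simp add: objective_def poly_eval_sum poly_eval_restrict)
  finally show ?thesis .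
qed

section \<open>Optimality of points assembled from the support sets\<close>

theorem theorem4p1:
  fixes m k t :: nat
    and \<Delta> :: "nat \<Rightarrow> 'n::finite set"
    and \<l> :: "nat \<Rightarrow> nat"
    and f :: "nat \<Rightarrow> 'n rpoly"
    and G :: "nat \<Rightarrow> 'n rpoly mat"
    and y :: "'n expo \<Rightarrow> real"
    and r :: "nat \<Rightarrow> nat"
    and u :: "nat \<Rightarrow> nat \<Rightarrow> 'n \<Rightarrow> real"
    and c :: "nat \<Rightarrow> nat \<Rightarrow> real"
    and X :: "nat \<Rightarrow> ('n \<Rightarrow> real) set"
  assumes cover: "(\<Union>i\<in>{1..m}. \<Delta> i) = UNIV"
    and f_in: "\<And>i. i \<in> {1..m} \<Longrightarrow> f i \<in> polys_in (\<Delta> i)"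
    and G_dim: "\<And>i. i \<in> {1..m} \<Longrightarrow> G i \<in> carrier_mat (\<l> i) (\<l> i)"
    and G_in: "\<And>i. i \<in> {1..m} \<Longrightarrow> elements_mat (G i) \<subseteq> polys_in (\<Delta> i)"
    and G_sym: "\<And>i. i \<in> {1..m} \<Longrightarrow> transpose_mat (G i) = G i"
    and k_ge: "min_order m f G \<le> k"
    and y_min: "is_arg_min (smo_objective m \<Delta> f k) (\<lambda>z. z \<in> smo_feasible m \<Delta> G k) y"
    and t_range: "t \<in> {min_order m f G..k}"
    and flat_r: "\<And>i. i \<in> {1..m} \<Longrightarrow>
          r i = mat_rank (moment_mat (\<Delta> i) t (subseq_moments (\<Delta> i) k y))"
    and flat: "\<And>i. i \<in> {1..m} \<Longrightarrow>
          mat_rank (moment_mat (\<Delta> i) t (subseq_moments (\<Delta> i) k y)) =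
          mat_rank (moment_mat (\<Delta> i) (t - half_deg (mat_deg (G i))) (subseq_moments (\<Delta> i) k y))"
    and same_value: "f_smo m \<Delta> f G t = f_smo m \<Delta> f G k"
    and u_distinct: "\<And>i. i \<in> {1..m} \<Longrightarrow> inj_on (u i) {1..r i}"
    and u_in: "\<And>i j. i \<in> {1..m} \<Longrightarrow> j \<in> {1..r i} \<Longrightarrow> u i j \<in> block_feasible (\<Delta> i) (G i)"
    and c_pos: "\<And>i j. i \<in> {1..m} \<Longrightarrow> j \<in> {1..r i} \<Longrightarrow> 0 < c i j"
    and c_sum: "\<And>i. i \<in> {1..m} \<Longrightarrow> (\<Sum>j=1..r i. c i j) = 1"
    and decomp: "\<And>i. i \<in> {1..m} \<Longrightarrow>
          restrict (subseq_moments (\<Delta> i) k y) (expos (\<Delta> i) (2 * t)) =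
          (\<lambda>\<alpha>\<in>expos (\<Delta> i) (2 * t). \<Sum>j=1..r i. c i j * monom_eval \<alpha> (u i j))"
    and X_def: "\<And>i. i \<in> {1..m} \<Longrightarrow> X i = u i ` {1..r i}"
  shows
    "(\<forall>x. (\<forall>i\<in>{1..m}. restrict x (\<Delta> i) \<in> X i) \<longrightarrow>
        f_min m \<Delta> f G = f_smo m \<Delta> f G k \<and>
        is_arg_min (poly_eval (objective m f)) (\<lambda>z. z \<in> feasible m \<Delta> G) x)
     \<and>
     (\<forall>x. (\<forall>i\<in>{1..m}. restrict x (\<Delta> i) \<in> X i) \<longrightarrow>
        f_spa m \<Delta> f G k = f_smo m \<Delta> f G k \<longrightarrow>
        f_min m \<Delta> f G = f_spa m \<Delta> f G k)"
proof -
  have "m \<noteq> 0"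
    using cover by auto
  then have m: "1 \<le> m" by simp
  have t: "min_order m f G \<le> t" and tk: "t \<le> k"
    using t_range by auto
  define v where "v = (\<Sum>i=1..m. \<Sum>j=1..r i. c i j * poly_eval (f i) (u i j))"
  have y: "y \<in> smo_feasible m \<Delta> G k"
    using y_min by (simp add: is_arg_min_def)
  have y_atomic: "atomic_on (expos (\<Delta> i) (2 * t)) {1..r i} (c i) (u i) (subseq_moments (\<Delta> i) k y)"
    if "i \<in> {1..m}" for i
    unfolding atomic_on_def
  proof
    fix \<alpha> assume "\<alpha> \<in> expos (\<Delta> i) (2 * t)"
    then show "subseq_moments (\<Delta> i) k y \<alpha> = (\<Sum>j=1..r i. c i j * monom_eval \<alpha> (u i j))"
      using fun_cong[OF decomp[OF that], of \<alpha>] by simp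
  qed
  have "smo_objective m \<Delta> f k y = v"
    unfolding smo_objective_def v_def
  proof (rule sum.cong)
    fix i assume i: "i \<in> {1..m}"
    show "riesz (subseq_moments (\<Delta> i) k y) (f i) =
        (\<Sum>j=1..r i. c i j * poly_eval (f i) (u i j))"
      using y_atomic[OF i] keys_subset_expos[OF f_in[OF i] deg_le_twice_order(1)[OF t i]]
      by (rule riesz_atomic)
  qed simp
  moreover have "f_smo m \<Delta> f G k = ereal (smo_objective m \<Delta> f k y)"
    unfolding f_smo_def
  proof (rule antisym)
    show "(INF z\<in>smo_feasible m \<Delta> G k. ereal (smo_objective m \<Delta> f k z))
        \<le> ereal (smo_objective m \<Delta> f k y)"
      using y by (rule INF_lower)
    show "ereal (smo_objective m \<Delta> f k y)
        \<le> (INF z\<in>smo_feasible m \<Delta> G k. ereal (smo_objective m \<Delta> f k z))"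
      using y_min by (intro INF_greatest) (auto simp: is_arg_min_def not_less)
  qed
  ultimately have f_smo_k: "f_smo m \<Delta> f G k = ereal v"
    by simp
  have lower: "v \<le> poly_eval (objective m f) x" if "x \<in> feasible m \<Delta> G" for x
    using f_smo_le_feasible[OF m k_ge f_in G_dim G_in that] by (simp add: f_smo_k)

  have support_point_optimal: "x \<in> feasible m \<Delta> G \<and> poly_eval (objective m f) x = v"
    if x: "\<forall>i\<in>{1..m}. restrict x (\<Delta> i) \<in> X i" for x
  proof
    have "\<exists>j\<in>{1..r i}. restrict x (\<Delta> i) = u i j" if "i \<in> {1..m}" for i
      using x X_def that by auto
    then obtain a where a: "\<And>i. i \<in> {1..m} \<Longrightarrow> a i \<in> {1..r i}"
      and xa: "\<And>i. i \<in> {1..m} \<Longrightarrow> restrict x (\<Delta> i) = u i (a i)"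
      by metis
    show x_feas: "x \<in> feasible m \<Delta> G"
      using u_in a xa by (auto simp: feasible_def)

    (* Halving the smallest weight makes \<theta> < 1 also when all blocks have a single atom. *)
    define \<theta> where "\<theta> = Min (insert 1 ((\<lambda>i. c i (a i)) ` {1..m})) / 2"
    have \<theta>: "0 < \<theta>" "\<theta> < 1"
    proof -
      have "Min (insert 1 ((\<lambda>i. c i (a i)) ` {1..m})) \<le> 1"
        by (rule Min_le) simp_all
      moreover have "0 < Min (insert 1 ((\<lambda>i. c i (a i)) ` {1..m}))"
        using c_pos a by (subst Min_gr_iff) auto
      ultimately show "0 < \<theta>" "\<theta> < 1"
        unfolding \<theta>_def by linarith+
    qed
    have \<theta>_le: "\<theta> \<le> c i (a i)" if "i \<in> {1..m}" for i
    proof -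
      have "2 * \<theta> \<le> c i (a i)"
        using that unfolding \<theta>_def by (simp del: Min_insert)
      with \<theta>(1) show ?thesis by simp
    qed
    define c' where "c' i j = (c i j - (if j = a i then \<theta> else 0)) / (1 - \<theta>)" for i j
    have c'_sum: "(\<Sum>j=1..r i. c' i j * h (u i j)) =
        ((\<Sum>j=1..r i. c i j * h (u i j)) - \<theta> * h (restrict x (\<Delta> i))) / (1 - \<theta>)"
      if i: "i \<in> {1..m}" for i and h :: "('n \<Rightarrow> real) \<Rightarrow> real"
    proof -
      have "(\<Sum>j=1..r i. c' i j * h (u i j)) = (\<Sum>j=1..r i.
          c i j * h (u i j) - (if j = a i then \<theta> * h (u i j) else 0)) / (1 - \<theta>)"
        unfolding sum_divide_distrib c'_def by (intro sum.cong) (auto simp: left_diff_distrib)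
      also have "(\<Sum>j=1..r i. c i j * h (u i j) - (if j = a i then \<theta> * h (u i j) else 0)) =
          (\<Sum>j=1..r i. c i j * h (u i j)) - \<theta> * h (restrict x (\<Delta> i))"
        using a[OF i] xa[OF i] by (simp add: sum_subtractf)
      finally show ?thesis .
    qed
    have c'_nonneg: "0 \<le> c' i j" if "i \<in> {1..m}" "j \<in> {1..r i}" for i j
      using that \<theta> \<theta>_le[of i] c_pos[of i j] by (auto simp: c'_def)

    (* the remaining part of y after the moments of x have been split off with weight \<theta> *)
    define z where "z = (\<lambda>\<alpha>\<in>moment_index m \<Delta> t. (y \<alpha> - \<theta> * monom_eval \<alpha> x) / (1 - \<theta>))"
    have z_atomic: "atomic_on (expos (\<Delta> i) (2 * t)) {1..r i} (c' i) (u i) z"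
      if i: "i \<in> {1..m}" for i
      unfolding atomic_on_def
    proof
      fix \<alpha> assume \<alpha>: "\<alpha> \<in> expos (\<Delta> i) (2 * t)"
      then have \<alpha>': "\<alpha> \<in> expos (\<Delta> i) (2 * k)"
        using expos_mono[of "2 * t" "2 * k" "\<Delta> i"] tk by auto
      have "subseq_moments (\<Delta> i) k y \<alpha> = (\<Sum>j=1..r i. c i j * monom_eval \<alpha> (u i j))"
        using y_atomic[OF i] \<alpha> unfolding atomic_on_def by blast
      then have "y \<alpha> = (\<Sum>j=1..r i. c i j * monom_eval \<alpha> (u i j))"
        using \<alpha>' by (simp add: subseq_moments_def)
      moreover have "monom_eval \<alpha> x = monom_eval \<alpha> (restrict x (\<Delta> i))"
        using \<alpha> by (simp add: monom_eval_restrict expos_def)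
      moreover have "\<alpha> \<in> moment_index m \<Delta> t"
        using i \<alpha> by (auto simp: moment_index_def)
      ultimately show "z \<alpha> = (\<Sum>j=1..r i. c' i j * monom_eval \<alpha> (u i j))"
        using c'_sum[OF i, of "monom_eval \<alpha>"] by (simp add: z_def)
    qed
    have "0 \<in> moment_index m \<Delta> t"
      using m zero_in_expos by (fastforce simp: moment_index_def)
    moreover have "y 0 = 1"
      using y by (simp add: smo_feasible_def)
    ultimately have "z 0 = 1" "z \<in> moment_index m \<Delta> t \<rightarrow>\<^sub>E UNIV"
      using \<theta> by (auto simp: z_def)
    then have "z \<in> smo_feasible m \<Delta> G t"
      by (intro smo_feasible_atomic[OF t G_dim G_in _ _ z_atomic] c'_nonneg u_in) auto
    then have "f_smo m \<Delta> f G t \<le> ereal (smo_objective m \<Delta> f t z)"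
      unfolding f_smo_def by (rule INF_lower)
    then have "v \<le> smo_objective m \<Delta> f t z"
      by (simp add: same_value f_smo_k)
    also have "\<dots> = (\<Sum>i=1..m. \<Sum>j=1..r i. c' i j * poly_eval (f i) (u i j))"
      by (rule smo_objective_atomic[OF t f_in z_atomic])
    also have "\<dots> = (\<Sum>i=1..m.
        ((\<Sum>j=1..r i. c i j * poly_eval (f i) (u i j)) - \<theta> * poly_eval (f i) x) / (1 - \<theta>))"
      by (intro sum.cong refl) (simp only: c'_sum poly_eval_restrict[OF f_in])
    also have "\<dots> = (v - \<theta> * poly_eval (objective m f) x) / (1 - \<theta>)"
      by (simp add: v_def objective_def poly_eval_sum sum_subtractf sum_distrib_left
          flip: sum_divide_distrib)
    finally have "\<theta> * poly_eval (objective m f) x \<le> \<theta> * v"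
      using \<theta> by (simp add: field_simps)
    then have "poly_eval (objective m f) x \<le> v"
      using \<theta> by simp
    with lower[OF x_feas] show "poly_eval (objective m f) x = v"
      by simp
  qed
  have "f_min m \<Delta> f G = f_smo m \<Delta> f G k \<and>
      is_arg_min (poly_eval (objective m f)) (\<lambda>z. z \<in> feasible m \<Delta> G) x"
    if x: "\<forall>i\<in>{1..m}. restrict x (\<Delta> i) \<in> X i" for x
  proof
    have feas: "x \<in> feasible m \<Delta> G" and val: "poly_eval (objective m f) x = v"
      using support_point_optimal[OF x] by auto
    show "is_arg_min (poly_eval (objective m f)) (\<lambda>z. z \<in> feasible m \<Delta> G) x"
      using feas val lower by (auto simp: is_arg_min_def not_less)
    show "f_min m \<Delta> f G = f_smo m \<Delta> f G k"
      unfolding f_min_def f_smo_k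
    proof (rule antisym)
      show "(INF x\<in>feasible m \<Delta> G. ereal (poly_eval (objective m f) x)) \<le> ereal v"
        using INF_lower[OF feas, of "\<lambda>x. ereal (poly_eval (objective m f) x)"] val by simp
      show "ereal v \<le> (INF x\<in>feasible m \<Delta> G. ereal (poly_eval (objective m f) x))"
        using lower by (intro INF_greatest) simp
    qed
  qed
  then show ?thesis
    by auto
qed

end
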